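(* Let $\mu_1$ be the 2-dimensional Leibniz algebra over $\mathbb R$ with basis $e_1,e_2$ whose only nonzero product of basis elements is $[e_1,e_1]=e_2$. Let $x=x_1e_1+x_2e_2\in\mu_1$ and let $E_{\mu_1,x}^T$ be the approximation by transposed of $\mu_1$ at $x$ with respect to this basis. Then $E_{\mu_1,x}^T$ is i) abelian if $x_1=0$; ii) isomorphic to $E_4$ if $x_1\neq0$, where $E_4$ is the 2-dimensional real evolution algebra with natural basis $f_1,f_2$ and $f_1f_1=f_2$, $f_2f_2=0$.
   Context: An $n$-dimensional evolution algebra is an algebra with a basis $\tilde e_1,\dots,\tilde e_n$ (natural basis) such that $\tilde e_p\tilde e_q=0$ for $p\neq q$ and $\tilde e_p^2=\sum_k b_{pk}\tilde e_k$; $(b_{pk})$ is its matrix of structural constants. Abelian means that all products are zero. For an $n$-dimensional algebra with basis $e_1,\dots,e_n$ and product $[e_i,e_j]=\sum_k\gamma_{ij,k}e_k$, and $x=\sum_ix_ie_i$, its approximation by transposed at $x$ is the $n$-dimensional evolution algebra with matrix of structural constants $(\beta_{pk}(x))_{p,k=1}^n$, $\beta_{pk}(x)=\sum_i(\gamma_{ki,p}+\gamma_{ik,p})x_i$. *)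

theory Defs
  imports "HOL-Analysis.Analysis"
begin

text \<open>A real algebra is a real vector space (the carrier type) with a bilinear product,
  and an \<open>n\<close>-dimensional one comes with a basis indexed by a finite type with \<open>n\<close> elements.\<close>

definition is_basis :: "('n::finite \<Rightarrow> 'a::real_vector) \<Rightarrow> bool" where
  "is_basis e \<longleftrightarrow> inj e \<and> independent (range e) \<and> span (range e) = UNIV"

definition coord :: "('n::finite \<Rightarrow> 'a::real_vector) \<Rightarrow> 'a \<Rightarrow> 'n \<Rightarrow> real" where
  "coord e v k = representation (range e) v (e k)"

text \<open>\<open>structure_const mul e i j k\<close> is the \<open>\<gamma>\<^sub>i\<^sub>j\<^sub>,\<^sub>k\<close> in \<open>[e\<^sub>i, e\<^sub>j] = \<Sum>\<^sub>k \<gamma>\<^sub>i\<^sub>j\<^sub>,\<^sub>k e\<^sub>k\<close>.\<close>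

definition structure_const ::
  "('a \<Rightarrow> 'a \<Rightarrow> 'a) \<Rightarrow> ('n::finite \<Rightarrow> 'a::real_vector) \<Rightarrow> 'n \<Rightarrow> 'n \<Rightarrow> 'n \<Rightarrow> real" where
  "structure_const mul e i j k = coord e (mul (e i) (e j)) k"

text \<open>Right Leibniz algebras. Where it is used below, all triple products vanish,
  so the left-handed convention would make no difference.\<close>

definition leibniz_algebra :: "('a::real_vector \<Rightarrow> 'a \<Rightarrow> 'a) \<Rightarrow> bool" where
  "leibniz_algebra mul \<longleftrightarrow> bilinear mul \<and>
     (\<forall>x y z. mul x (mul y z) = mul (mul x y) z - mul (mul x z) y)"

definition abelian_algebra :: "('a::real_vector \<Rightarrow> 'a \<Rightarrow> 'a) \<Rightarrow> bool" where
  "abelian_algebra mul \<longleftrightarrow> (\<forall>x y. mul x y = 0)"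

definition isomorphic_algebras ::
  "('a::real_vector \<Rightarrow> 'a \<Rightarrow> 'a) \<Rightarrow> ('b::real_vector \<Rightarrow> 'b \<Rightarrow> 'b) \<Rightarrow> bool" where
  "isomorphic_algebras mul mul' \<longleftrightarrow>
     (\<exists>f. linear f \<and> bij f \<and> (\<forall>x y. f (mul x y) = mul' (f x) (f y)))"

definition evolution_algebra ::
  "('a::real_vector \<Rightarrow> 'a \<Rightarrow> 'a) \<Rightarrow> ('n::finite \<Rightarrow> 'a) \<Rightarrow> bool" where
  "evolution_algebra mul e \<longleftrightarrow> bilinear mul \<and> is_basis e \<and>
     (\<forall>p q. p \<noteq> q \<longrightarrow> mul (e p) (e q) = 0)"

text \<open>The evolution algebra with a given matrix of structural constants, realised on
  \<open>real ^ 'n\<close> with the standard basis as natural basis.\<close>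

definition evolution_product :: "real ^ 'n ^ 'n \<Rightarrow> real ^ 'n \<Rightarrow> real ^ 'n \<Rightarrow> real ^ 'n" where
  "evolution_product B u v = (\<Sum>p\<in>UNIV. (u $ p * v $ p) *\<^sub>R (\<Sum>k\<in>UNIV. (B $ p $ k) *\<^sub>R axis k 1))"

definition approx_transposed_matrix ::
  "('a \<Rightarrow> 'a \<Rightarrow> 'a) \<Rightarrow> ('n::finite \<Rightarrow> 'a::real_vector) \<Rightarrow> 'a \<Rightarrow> real ^ 'n ^ 'n" where
  "approx_transposed_matrix mul e x =
     (\<chi> p k. \<Sum>i\<in>UNIV. (structure_const mul e k i p + structure_const mul e i k p) * coord e x i)"

definition approx_transposed ::
  "('a \<Rightarrow> 'a \<Rightarrow> 'a) \<Rightarrow> ('n::finite \<Rightarrow> 'a::real_vector) \<Rightarrow> 'a \<Rightarrow> real ^ 'n \<Rightarrow> real ^ 'n \<Rightarrow> real ^ 'n" where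
  "approx_transposed mul e x = evolution_product (approx_transposed_matrix mul e x)"

lemma is_basis_axis: "is_basis (\<lambda>i::'n::finite. axis i (1::real))"
proof -
  have r: "range (\<lambda>i::'n. axis i (1::real)) = Basis"
    by (auto simp: Basis_vec_def)
  show ?thesis
    unfolding is_basis_def r
    by (simp add: independent_Basis span_Basis inj_def axis_eq_axis)
qed

lemma evolution_product_axis:
  "evolution_product B (axis p 1) (axis q 1) =
     (if p = q then \<Sum>k\<in>UNIV. (B $ p $ k) *\<^sub>R axis k 1 else 0)"
proof -
  have "evolution_product B (axis p 1) (axis q 1) =
      (\<Sum>r\<in>UNIV. if r = p then (if p = q then \<Sum>k\<in>UNIV. (B $ p $ k) *\<^sub>R axis k 1 else 0) else 0)"
    unfolding evolution_product_def by (rule sum.cong) (auto simp: axis_def)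
  then show ?thesis by simp
qed

lemma bilinear_evolution_product: "bilinear (evolution_product B)"
  unfolding bilinear_def evolution_product_def
  by (auto intro!: linearI
      simp: algebra_simps scaleR_add_left sum.distrib scaleR_sum_right)

lemma evolution_algebra_evolution_product:
  "evolution_algebra (evolution_product B) (\<lambda>i. axis i 1)"
  by (simp add: evolution_algebra_def is_basis_axis bilinear_evolution_product
      evolution_product_axis)

text \<open>The two-dimensional algebra whose only nonzero product of basis elements is
  \<open>[e\<^sub>1, e\<^sub>1] = e\<^sub>2\<close> exists and is a Leibniz algebra (and an evolution algebra).\<close>

lemma exists_leibniz_e1e1_eq_e2:
  "\<exists>(mul :: real ^ 2 \<Rightarrow> real ^ 2 \<Rightarrow> real ^ 2) (e :: 2 \<Rightarrow> real ^ 2).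
     leibniz_algebra mul \<and> evolution_algebra mul e \<and> mul (e 1) (e 1) = e 2 \<and>
     mul (e 1) (e 2) = 0 \<and> mul (e 2) (e 1) = 0 \<and> mul (e 2) (e 2) = 0"
proof -
  define B :: "real ^ 2 ^ 2" where "B = (\<chi> p k. if p = 1 \<and> k = 2 then 1 else 0)"
  have "leibniz_algebra (evolution_product B)"
    unfolding leibniz_algebra_def
    by (simp add: bilinear_evolution_product)
       (simp add: evolution_product_def B_def sum_2 axis_def vec_eq_iff forall_2)
  moreover have "evolution_product B (axis 1 1) (axis 1 1) = axis 2 1"
    "evolution_product B (axis 1 1) (axis 2 1) = 0"
    "evolution_product B (axis 2 1) (axis 1 1) = 0"
    "evolution_product B (axis 2 1) (axis 2 1) = 0"
    by (simp_all add: evolution_product_axis B_def sum_2)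
  ultimately show ?thesis
    using evolution_algebra_evolution_product[of B]
    by (intro exI[of _ "evolution_product B"] exI[of _ "\<lambda>i. axis i 1"]) simp
qed

end

theory Submission
  imports Defs
begin

text \<open>The only nonzero structural constant of \<open>\<mu>\<^sub>1\<close> is the one of
  \<open>e 2\<close> in \<open>[e 1, e 1]\<close>, so the only entry of the transposed matrix that
  can survive is in row 2, column 1, and it equals \<open>2 * x\<^sub>1\<close>
  (\<open>approx_transposed_nilpotent_2\<close>). In the natural basis \<open>axis 1 1\<close>,
  \<open>axis 2 1\<close> the approximation thus has a single possible product: the square of the
  second vector is \<open>2 * x\<^sub>1\<close> times the first. It vanishes if
  \<open>x\<^sub>1 = 0\<close>; otherwise swapping the two basis vectors and rescaling one of them
  gives \<open>E\<^sub>4\<close>.\<close>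

lemma coord_lincomb:
  fixes e :: "'n::finite \<Rightarrow> 'a::real_vector"
  assumes "is_basis e"
  shows "coord e (\<Sum>i\<in>UNIV. c i *\<^sub>R e i) k = c k"
proof -
  have ind: "independent (range e)" and inj: "inj e"
    using assms by (auto simp: is_basis_def)
  have "representation (range e) (\<Sum>i\<in>UNIV. c i *\<^sub>R e i)
      = (\<lambda>b. \<Sum>i\<in>UNIV. representation (range e) (c i *\<^sub>R e i) b)"
    using ind by (intro representation_sum) (auto intro: span_scale span_base)
  then have "coord e (\<Sum>i\<in>UNIV. c i *\<^sub>R e i) k
      = (\<Sum>i\<in>UNIV. c i * representation (range e) (e i) (e k))"
    using ind by (simp add: coord_def representation_scale span_base)
  also have "\<dots> = (\<Sum>i\<in>UNIV. if i = k then c i else 0)"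
    using ind by (intro sum.cong) (auto simp: representation_basis inj_eq[OF inj])
  finally show ?thesis by simp
qed

lemma sum_coord:
  fixes e :: "'n::finite \<Rightarrow> 'a::real_vector"
  assumes "is_basis e"
  shows "(\<Sum>i\<in>UNIV. coord e v i *\<^sub>R e i) = v"
proof -
  have "(\<Sum>b\<in>range e. representation (range e) v b *\<^sub>R b) = v"
    using assms by (intro sum_representation_eq) (auto simp: is_basis_def)
  then show ?thesis
    using assms by (simp add: is_basis_def coord_def sum.reindex)
qed

lemma coord_lincomb_2:
  fixes e :: "2 \<Rightarrow> 'a::real_vector"
  assumes "is_basis e"
  shows "coord e (a *\<^sub>R e 1 + b *\<^sub>R e 2) k = (if k = 1 then a else b)"
  using coord_lincomb[OF assms, of "\<lambda>i. if i = 1 then a else b" k] by (simp add: sum_2)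

lemma sum_coord_2:
  fixes e :: "2 \<Rightarrow> 'a::real_vector"
  assumes "is_basis e"
  shows "coord e v 1 *\<^sub>R e 1 + coord e v 2 *\<^sub>R e 2 = v"
  using sum_coord[OF assms, of v] by (simp add: sum_2)

text \<open>The entry at p, k needs \<open>[e k, e i]\<close> or \<open>[e i, e k]\<close> to have a
  component along \<open>e p\<close>, which forces k = i = 1 and p = 2. Both summands then
  contribute 1, hence the factor 2; the coefficient \<open>b\<close> is never seen.\<close>

lemma approx_transposed_nilpotent_2:
  fixes e :: "2 \<Rightarrow> 'a::real_vector"
  assumes e: "is_basis e"
    and mul: "mul (e 1) (e 1) = e 2" "mul (e 1) (e 2) = 0" "mul (e 2) (e 1) = 0" "mul (e 2) (e 2) = 0"
  shows "approx_transposed mul e (a *\<^sub>R e 1 + b *\<^sub>R e 2) u v = (2 * a * u $ 2 * v $ 2) *\<^sub>R axis 1 1"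
proof -
  \<comment> \<open>Every product of basis vectors is \<open>e 2\<close> or 0, so these coordinates
    determine all structural constants.\<close>
  have "coord e (e 2) k = (if k = 1 then 0 else 1)" "coord e 0 k = 0" for k
    using coord_lincomb_2[OF e, of 0 1 k] coord_lincomb_2[OF e, of 0 0 k] by auto
  then show ?thesis
    by (simp add: approx_transposed_def evolution_product_def approx_transposed_matrix_def
        structure_const_def sum_2 mul coord_lincomb_2[OF e])
qed

theorem proposition4p8:
  fixes \<mu>\<^sub>1 :: "'a::real_vector \<Rightarrow> 'a \<Rightarrow> 'a" and e :: "2 \<Rightarrow> 'a"
    and E\<^sub>4 :: "'b::real_vector \<Rightarrow> 'b \<Rightarrow> 'b" and f :: "2 \<Rightarrow> 'b"
    and x :: 'a and x\<^sub>1 x\<^sub>2 :: real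
  assumes "leibniz_algebra \<mu>\<^sub>1" and "is_basis e"
    and "\<mu>\<^sub>1 (e 1) (e 1) = e 2" and "\<mu>\<^sub>1 (e 1) (e 2) = 0"
    and "\<mu>\<^sub>1 (e 2) (e 1) = 0" and "\<mu>\<^sub>1 (e 2) (e 2) = 0"
    and "evolution_algebra E\<^sub>4 f"
    and "E\<^sub>4 (f 1) (f 1) = f 2" and "E\<^sub>4 (f 2) (f 2) = 0"
    and "x = x\<^sub>1 *\<^sub>R e 1 + x\<^sub>2 *\<^sub>R e 2"
  shows "(x\<^sub>1 = 0 \<longrightarrow> abelian_algebra (approx_transposed \<mu>\<^sub>1 e x)) \<and>
    (x\<^sub>1 \<noteq> 0 \<longrightarrow> isomorphic_algebras (approx_transposed \<mu>\<^sub>1 e x) E\<^sub>4)"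
proof (intro conjI impI)
  note product = approx_transposed_nilpotent_2[OF assms(2-6), of x\<^sub>1 x\<^sub>2, folded assms(10)]
  show "abelian_algebra (approx_transposed \<mu>\<^sub>1 e x)" if "x\<^sub>1 = 0"
    using that by (simp add: abelian_algebra_def product)
  assume "x\<^sub>1 \<noteq> 0"
  have f: "is_basis f" and bil: "bilinear E\<^sub>4" and "E\<^sub>4 (f 1) (f 2) = 0" "E\<^sub>4 (f 2) (f 1) = 0"
    using assms(7) by (auto simp: evolution_algebra_def)
  note E\<^sub>4 = this(3,4) assms(8,9)
  \<comment> \<open>The vector \<open>axis 2 1\<close>, whose square is nonzero, goes to the
    generator \<open>f 1\<close>. Multiplicativity then forces \<open>2 * x\<^sub>1\<close> times
    \<open>axis 1 1\<close> to go to \<open>f 2\<close>, whence the division. \<open>G\<close> is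
    the inverse, read off from coordinates in \<open>f\<close>.\<close>
  define F :: "real ^ 2 \<Rightarrow> 'b" where "F u = u $ 2 *\<^sub>R f 1 + (u $ 1 / (2 * x\<^sub>1)) *\<^sub>R f 2" for u
  define G :: "'b \<Rightarrow> real ^ 2"
    where "G y = (\<chi> k. if k = 1 then 2 * x\<^sub>1 * coord f y 2 else coord f y 1)" for y
  have "linear F"
    by (rule linearI) (simp_all add: F_def algebra_simps add_divide_distrib)
  moreover have "bij F"
  proof (rule o_bij)
    show "G \<circ> F = id"
      using \<open>x\<^sub>1 \<noteq> 0\<close> by (simp add: fun_eq_iff F_def G_def coord_lincomb_2[OF f] vec_eq_iff forall_2)
    show "F \<circ> G = id"
      using \<open>x\<^sub>1 \<noteq> 0\<close> by (simp add: fun_eq_iff F_def G_def sum_coord_2[OF f])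
  qed
  moreover have "F (approx_transposed \<mu>\<^sub>1 e x u v) = E\<^sub>4 (F u) (F v)" for u v
  proof -
    have "F (approx_transposed \<mu>\<^sub>1 e x u v) = (u $ 2 * v $ 2) *\<^sub>R f 2"
      using \<open>x\<^sub>1 \<noteq> 0\<close> by (simp add: product F_def axis_def)
    \<comment> \<open>In the bilinear expansion only the term with \<open>f 1\<close> squared
      survives, and its coefficients are \<open>u $ 2\<close> and \<open>v $ 2\<close>.\<close>
    also have "\<dots> = E\<^sub>4 (F u) (F v)"
      by (simp add: F_def E\<^sub>4 bilinear_ladd[OF bil] bilinear_radd[OF bil]
          bilinear_lmul[OF bil] bilinear_rmul[OF bil] mult.commute)
    finally show ?thesis .
  qed
  ultimately show "isomorphic_algebras (approx_transposed \<mu>\<^sub>1 e x) E\<^sub>4"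
    unfolding isomorphic_algebras_def by blast
qed

end
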